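(* Let $n$ be a positive integer, let $k\geq 2$ be an integer, and let $f:V(C_n)\to\{1,\ldots,k\}$ be a surjective function. Then $f$ is a $k$-color weak maximizer of $W$ on $C_n$ if and only if for every $i\in\{1,\ldots,k\}$ the set $V_i=f^{-1}(i)$ is a maximizer of $W$ on $C_n$.
   Context: $C_n$ is the cycle on $n$ vertices (vertices $0,\ldots,n-1$, with distinct vertices $i,j$ adjacent iff $i-j\equiv\pm1 \pmod n$). For a finite simple connected graph $G$, $d_G(u,v)$ is the length of a shortest path from $u$ to $v$. For $A\subseteq V(G)$, the Wiener index of $A$ in $G$ is $W_G(A)=W(A)=\sum_{\{u,v\}\in\binom{A}{2}}d_G(u,v)$. A set $A\subseteq V(G)$ is a maximizer of $W$ on $G$ if $W(A)=\max\{W(A') : A'\subseteq V(G),\ |A'|=|A|\}$. A $k$-coloring of $G$ is any function $f:V(G)\to\{1,\ldots,k\}$ (adjacent vertices may share a color). Its type, $\mathrm{type}(f)$, is the $k$-tuple of the cardinalities $|f^{-1}(1)|,\ldots,|f^{-1}(k)|$ arranged in non-decreasing order, and its Wiener index is $W(f)=\sum_{i=1}^k W(f^{-1}(i))$. For $k\ge 2$, $f$ is a $k$-color weak maximizer of $W$ on $G$ if $f$ is surjective and $W(f)\geq W(f')$ for all surjective $f':V(G)\to\{1,\ldots,k\}$ with $\mathrm{type}(f')=\mathrm{type}(f)$. *)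

theory Defs
  imports "HOL-Number_Theory.Cong" "Graph_Theory.Graph_Theory"
begin

text \<open>A finite simple graph is a pair digraph satisfying the locale \<open>pair_graph\<close>:
  every undirected edge is represented by its two orientations.\<close>

definition cycle_graph :: "nat \<Rightarrow> nat pair_pre_digraph" where
  "cycle_graph n = \<lparr> pverts = {0..<n},
     parcs = {(i, j). i < n \<and> j < n \<and> i \<noteq> j \<and>
       ([int i - int j = 1] (mod int n) \<or> [int i - int j = - 1] (mod int n))} \<rparr>"

text \<open>Meaningful if some path joins the two vertices; for vertices of a connected graph one always does.\<close>

definition graph_dist :: "'a pair_pre_digraph \<Rightarrow> 'a \<Rightarrow> 'a \<Rightarrow> nat" where
  "graph_dist G u v = (LEAST l. \<exists>p. pre_digraph.apath (with_proj G) u p v \<and> length p = l)"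

text \<open>The distance as a function of the unordered pair \<open>{u, v}\<close>; it is well defined on
  graphs since \<open>graph_dist\<close> is symmetric there (see \<open>pair_dist_insert\<close> below).\<close>

definition pair_dist :: "'a pair_pre_digraph \<Rightarrow> 'a set \<Rightarrow> nat" where
  "pair_dist G e = (THE d. \<exists>u v. e = {u, v} \<and> d = graph_dist G u v)"

definition wiener :: "'a pair_pre_digraph \<Rightarrow> 'a set \<Rightarrow> nat" where
  "wiener G A = (\<Sum>e \<in> {e. e \<subseteq> A \<and> card e = 2}. pair_dist G e)"

definition wiener_maximizer :: "'a pair_pre_digraph \<Rightarrow> 'a set \<Rightarrow> bool" where
  "wiener_maximizer G A \<longleftrightarrow> A \<subseteq> pverts G \<and>
     wiener G A = Max {wiener G A' | A'. A' \<subseteq> pverts G \<and> card A' = card A}"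

text \<open>Colorings with colors \<open>1, \<dots>, k\<close> are functions on the whole vertex type; only
  their values on \<open>pverts G\<close> matter.\<close>

definition surj_coloring :: "'a pair_pre_digraph \<Rightarrow> nat \<Rightarrow> ('a \<Rightarrow> nat) \<Rightarrow> bool" where
  "surj_coloring G k f \<longleftrightarrow> f ` pverts G = {1..k}"

definition color_class :: "'a pair_pre_digraph \<Rightarrow> ('a \<Rightarrow> nat) \<Rightarrow> nat \<Rightarrow> 'a set" where
  "color_class G f i = {v \<in> pverts G. f v = i}"

definition coloring_type :: "'a pair_pre_digraph \<Rightarrow> nat \<Rightarrow> ('a \<Rightarrow> nat) \<Rightarrow> nat list" where
  "coloring_type G k f = sort (map (\<lambda>i. card (color_class G f i)) [1..<Suc k])"

definition coloring_wiener :: "'a pair_pre_digraph \<Rightarrow> nat \<Rightarrow> ('a \<Rightarrow> nat) \<Rightarrow> nat" where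
  "coloring_wiener G k f = (\<Sum>i = 1..k. wiener G (color_class G f i))"

definition weak_maximizer :: "'a pair_pre_digraph \<Rightarrow> nat \<Rightarrow> ('a \<Rightarrow> nat) \<Rightarrow> bool" where
  "weak_maximizer G k f \<longleftrightarrow> surj_coloring G k f \<and>
     (\<forall>f'. surj_coloring G k f' \<and> coloring_type G k f' = coloring_type G k f \<longrightarrow>
        coloring_wiener G k f' \<le> coloring_wiener G k f)"

lemma pair_graph_cycle_graph: "pair_graph (cycle_graph n)"
proof -
  have sub: "parcs (cycle_graph n) \<subseteq> {0..<n} \<times> {0..<n}"
    by (auto simp: cycle_graph_def)
  have "(j, i) \<in> parcs (cycle_graph n)" if "(i, j) \<in> parcs (cycle_graph n)" for i j
  proof -
    have "[int j - int i = - c] (mod int n)" if "[int i - int j = c] (mod int n)" for c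
      using cong_minus_minus_iff[of "int i - int j" c "int n"] that by simp
    from this[of 1] this[of "- 1"] that show ?thesis
      by (auto simp: cycle_graph_def)
  qed
  then have sym: "symmetric (with_proj (cycle_graph n))"
    unfolding symmetric_def by (auto intro!: symI)
  show ?thesis
    by unfold_locales
      (use sub sym finite_subset[OF sub] in \<open>auto simp: cycle_graph_def\<close>)
qed

lemma connected_cycle_graph:
  assumes "n > 0"
  shows "connected (with_proj (cycle_graph n))"
proof -
  interpret pair_graph "cycle_graph n" by (rule pair_graph_cycle_graph)
  have from0: "0 \<rightarrow>\<^sup>*\<^bsub>with_proj (cycle_graph n)\<^esub> i" if "i < n" for i
    using that
  proof (induction i)
    case 0
    then show ?case by (intro reachable_refl) (simp add: cycle_graph_def)
  next
    case (Suc i)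
    have "(i, Suc i) \<in> parcs (cycle_graph n)"
      using Suc.prems by (auto simp: cycle_graph_def)
    with Suc show ?case by (meson Suc_lessD reachable_adj_trans)
  qed
  have "i \<rightarrow>\<^sup>*\<^bsub>with_proj (cycle_graph n)\<^esub> j" if "i < n" "j < n" for i j
    using from0[OF that(1)] from0[OF that(2)]
    by (meson reachable_trans symmetric_reachable sym_arcs)
  then have "strongly_connected (with_proj (mk_symmetric (with_proj (cycle_graph n))))"
    using assms
    by (intro strongly_connectedI)
      (simp_all only: with_proj_simps pverts_mk_symmetric
        reachable_mk_symmetric_eq[OF sym_arcs], simp_all add: cycle_graph_def)
  then show ?thesis
    by (simp only: connected_def)
qed

lemma graph_dist_commute:
  fixes G :: "'a pair_pre_digraph"
  assumes "pair_graph G"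
  shows "graph_dist G u v = graph_dist G v u"
proof -
  interpret pair_graph G by fact
  have length_rev_path: "length (rev_path p) = length p" for p :: "('a \<times> 'a) list"
    by (induction p) auto
  have "\<exists>q. apath y q x \<and> length q = length p" if "apath x p y" for x y p
    using that by (intro exI[of _ "rev_path p"]) (simp add: length_rev_path)
  then have "(\<exists>p. apath u p v \<and> length p = l) \<longleftrightarrow> (\<exists>p. apath v p u \<and> length p = l)" for l
    by metis
  then show ?thesis by (simp add: graph_dist_def)
qed

lemma pair_dist_insert:
  assumes "pair_graph G"
  shows "pair_dist G {u, v} = graph_dist G u v"
  unfolding pair_dist_def
  by (rule the_equality) (auto simp: doubleton_eq_iff graph_dist_commute[OF assms])

end

theory Submission
  imports Defs
begin

text \<open>If every class is a maximizer, then \<open>f\<close> attains the sum over the classes of the largest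
  Wiener index possible for their sizes; this sum depends only on the type and bounds
  every coloring of that type.

  For the converse it suffices to exhibit one coloring \<open>g\<close> whose classes have the same sizes
  as those of \<open>f\<close> and are all maximizers: comparing \<open>f\<close> with \<open>g\<close> then forces equality in every
  class. So the content is that the vertices of the cycle can be partitioned into maximizers of
  any prescribed sizes.

  A half arc is a set of \<open>n div 2\<close> consecutive vertices. Exactly \<open>2 d(u, v)\<close> of the \<open>n\<close> half arcs
  separate \<open>u\<close> from \<open>v\<close> (\<open>card_half_arcs_separating\<close>), so \<open>2 W(A)\<close> is the sum of
  \<open>c (a - c)\<close> over the half arcs, where \<open>a = card A\<close> and \<open>c\<close> counts the elements of \<open>A\<close> in
  the half arc. The sum of the \<open>c\<close> is determined by \<open>a\<close>, so a multiple of it may be added: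
  with \<open>q = (a + 1) div 2\<close>, maximizing \<open>W\<close> amounts to minimizing the sum of
  \<open>(c - q) (c - q + 1)\<close>, a product of two consecutive integers and hence nonnegative. Therefore \<open>A\<close> is a
  maximizer as soon as every half arc contains \<open>q\<close> or \<open>q - 1\<close> of its elements
  (\<open>balanced_wiener_ge\<close>).

  Balanced sets come from listing the vertices in the zigzag order
  \<open>0, m, -1, m - 1, -2, m - 2, \<dots>\<close> modulo \<open>n\<close>, where \<open>m = n div 2\<close>. A half arc contains
  exactly one of two vertices at distance \<open>m\<close>, except that for odd \<open>n\<close> one pair of neighbours in
  the list may be missed altogether. Hence intervals of the list are balanced, provided that for
  even \<open>n\<close> those of even length start at an even position (\<open>balanced_zigzag_interval\<close>). Cutting
  the list into consecutive intervals of the prescribed sizes, the even sizes first, meets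
  this proviso.\<close>

section \<open>Distances in the cycle\<close>

lemma (in pair_graph) graph_dist_le_length:
  assumes "awalk u p v"
  shows "graph_dist G u v \<le> length p"
proof -
  let ?q = "awalk_to_apath p"
  have q: "apath u ?q v" using assms by (rule apath_awalk_to_apath)
  then have "distinct ?q" by (auto simp: apath_def intro: distinct_verts_imp_distinct)
  then have "length ?q = card (set ?q)" by (simp add: distinct_card)
  also have "\<dots> \<le> card (set p)"
    using awalk_to_apath_subset[OF assms] by (simp add: card_mono)
  also have "\<dots> \<le> length p" by (rule card_length)
  finally have "length ?q \<le> length p" .
  moreover have "graph_dist G u v \<le> length ?q"
    unfolding graph_dist_def using q by (intro Least_le) auto
  ultimately show ?thesis by simp
qed

lemma (in pair_graph) shortest_walk_exists:
  assumes "awalk u p v"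
  obtains q where "awalk u q v" "length q = graph_dist G u v"
proof -
  have "\<exists>l q. apath u q v \<and> length q = l"
    using apath_awalk_to_apath[OF assms] by blast
  then have "\<exists>q. apath u q v \<and> length q = graph_dist G u v"
    unfolding graph_dist_def by (rule LeastI_ex)
  then show ?thesis using that awalkI_apath by blast
qed

lemma pverts_cycle_graph [simp]: "pverts (cycle_graph n) = {0..<n}"
  by (simp add: cycle_graph_def)

lemma cycle_graph_walk_forward:
  assumes "n > 0" "u < n"
  shows "\<exists>p. pre_digraph.awalk (with_proj (cycle_graph n)) u p ((u + l) mod n) \<and>
    length p \<le> l"
proof -
  interpret pair_graph "cycle_graph n" by (rule pair_graph_cycle_graph)
  show ?thesis
  proof (induction l)
    case 0
    then show ?case using assms by (intro exI[of _ "[]"]) (simp add: awalk_Nil_iff)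
  next
    case (Suc l)
    then obtain p where p: "awalk u p ((u + l) mod n)" "length p \<le> l" by blast
    let ?a = "(u + l) mod n" and ?b = "(u + Suc l) mod n"
    show ?case
    proof (cases "n = 1")
      case True
      then show ?thesis using p by (intro exI[of _ p]) simp
    next
      case False
      have "?a \<noteq> ?b" using assms False by (auto simp: mod_Suc)
      moreover have "[int ?a - int ?b = - 1] (mod int n)"
      proof -
        have "[int ?a - int ?b = int (u + l) - int (u + Suc l)] (mod int n)"
          by (intro cong_diff) (simp_all add: cong_def zmod_int)
        then show ?thesis by simp
      qed
      ultimately have "(?a, ?b) \<in> parcs (cycle_graph n)"
        using assms by (simp add: cycle_graph_def)
      then have "awalk ?a [(?a, ?b)] ?b" using arc_implies_awalk by fastforce
      with p(1) have "awalk u (p @ [(?a, ?b)]) ?b" by (rule awalk_appendI)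
      then show ?thesis using p(2) by (intro exI[of _ "p @ [(?a, ?b)]"]) simp
    qed
  qed
qed

lemma graph_dist_cycle_graph_le:
  assumes "u < n" "v < n"
  shows "int (graph_dist (cycle_graph n) u v) \<le> (int v - int u) mod int n"
proof -
  interpret pair_graph "cycle_graph n" by (rule pair_graph_cycle_graph)
  define l where "l = nat ((int v - int u) mod int n)"
  have l: "int l = (int v - int u) mod int n" using assms by (simp add: l_def)
  have "int ((u + l) mod n) = int v"
    using assms by (simp add: zmod_int l mod_simps)
  then have "(u + l) mod n = v" by simp
  moreover have "n > 0" using assms by simp
  ultimately obtain p where "awalk u p v" "length p \<le> l"
    using cycle_graph_walk_forward[of n u l] assms by metis
  then show ?thesis using graph_dist_le_length[of u p v] l by linarith
qed

text \<open>One step along the cycle changes the offset of a vertex from a fixed target by one, so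
  the cyclic distance grows by at most one. This bounds the length of walks from below.\<close>

lemma residue_min_step:
  fixes x y n :: int
  assumes "n > 0" "[x - y = 1] (mod n) \<or> [x - y = - 1] (mod n)"
  shows "min (x mod n) (- x mod n) \<le> min (y mod n) (- y mod n) + 1"
proof -
  have neg: "- z mod n = (if z mod n = 0 then 0 else n - z mod n)" for z
    by (simp add: zmod_zminus1_eq_if)
  have succ: "(z + 1) mod n = (if z mod n + 1 = n then 0 else z mod n + 1)" for z
  proof -
    have "(z + 1) mod n = (z mod n + 1) mod n" by (simp add: mod_simps)
    moreover have "0 \<le> z mod n" "z mod n < n" using assms(1) by simp_all
    ultimately show ?thesis by auto
  qed
  have "x mod n = (y + 1) mod n \<or> y mod n = (x + 1) mod n"
    using assms(2)
  proof
    assume "[x - y = 1] (mod n)"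
    then have "[x - y + y = 1 + y] (mod n)" by (intro cong_add) auto
    then show ?thesis by (simp add: cong_def add.commute)
  next
    assume "[x - y = - 1] (mod n)"
    then have "[x - y + (y + 1) = - 1 + (y + 1)] (mod n)" by (intro cong_add) auto
    then show ?thesis by (simp add: cong_def)
  qed
  moreover have "0 \<le> x mod n" "x mod n < n" "0 \<le> y mod n" "y mod n < n"
    using assms(1) by simp_all
  ultimately show ?thesis unfolding neg succ by (auto split: if_splits)
qed

lemma cycle_graph_walk_length_ge:
  assumes "n > 0" "pre_digraph.awalk (with_proj (cycle_graph n)) u p v"
  shows "min ((int v - int u) mod int n) ((int u - int v) mod int n) \<le> int (length p)"
proof -
  interpret pair_graph "cycle_graph n" by (rule pair_graph_cycle_graph)
  show ?thesis
    using assms(2)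
  proof (induction p arbitrary: u)
    case Nil
    then show ?case by (simp add: awalk_Nil_iff)
  next
    case (Cons e p)
    obtain w where e: "(u, w) \<in> parcs (cycle_graph n)" "awalk w p v"
      using Cons.prems by (cases e) (auto simp: awalk_Cons_iff)
    have "[(int u - int v) - (int w - int v) = 1] (mod int n) \<or>
          [(int u - int v) - (int w - int v) = - 1] (mod int n)"
      using e(1) by (simp add: cycle_graph_def)
    from residue_min_step[OF _ this] Cons.IH[OF e(2)] assms(1)
    show ?case by (simp add: min.commute)
  qed
qed

lemma graph_dist_cycle_graph:
  assumes "u < n" "v < n"
  shows "int (graph_dist (cycle_graph n) u v) =
    min ((int v - int u) mod int n) ((int u - int v) mod int n)"
proof -
  interpret pair_graph "cycle_graph n" by (rule pair_graph_cycle_graph)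
  have n: "n > 0" using assms by simp
  have "(u + nat ((int v - int u) mod int n)) mod n = v"
  proof -
    have "int ((u + nat ((int v - int u) mod int n)) mod n) = int v"
      using assms by (simp add: zmod_int mod_simps)
    then show ?thesis by simp
  qed
  then obtain p where "awalk u p v"
    using cycle_graph_walk_forward[OF n assms(1)] by metis
  then obtain q where "awalk u q v" "length q = graph_dist (cycle_graph n) u v"
    by (rule shortest_walk_exists)
  with cycle_graph_walk_length_ge[OF n] have
    "min ((int v - int u) mod int n) ((int u - int v) mod int n)
      \<le> int (graph_dist (cycle_graph n) u v)" by metis
  moreover have "graph_dist (cycle_graph n) u v = graph_dist (cycle_graph n) v u"
    by (rule graph_dist_commute[OF pair_graph_cycle_graph])
  ultimately show ?thesis
    using graph_dist_cycle_graph_le[OF assms] graph_dist_cycle_graph_le[OF assms(2,1)]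
    by simp
qed

section \<open>Half arcs and the Wiener index\<close>

definition half_arc :: "nat \<Rightarrow> nat \<Rightarrow> nat set" where
  "half_arc n x = {v. v < n \<and> (int v - int x) mod int n < int (n div 2)}"

text \<open>Reflection \<open>x \<mapsto> v - x\<close> permutes the residues, so counting start points of half arcs becomes
  counting positions inside the arc.\<close>

lemma card_by_offset:
  assumes "v < n"
  shows "card {x. x < n \<and> P ((int v - int x) mod int n)} = card {y. y < n \<and> P (int y)}"
proof (rule bij_betw_same_card)
  let ?g = "\<lambda>x. nat ((int v - int x) mod int n)"
  have n: "n > 0" using assms by simp
  have inv: "?g (?g x) = x" if "x < n" for x
    using that n by (simp add: mod_simps)
  have lt: "?g x < n" for x using n by (simp add: nat_less_iff)
  have P: "int (?g x) = (int v - int x) mod int n" for x using n by simp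
  show "bij_betw ?g {x. x < n \<and> P ((int v - int x) mod int n)} {y. y < n \<and> P (int y)}"
    by (rule bij_betw_byWitness[where f' = ?g])
      (use inv lt P n in \<open>auto simp: mod_simps\<close>)
qed

lemma card_half_arcs_containing:
  assumes "v < n"
  shows "card {x. x < n \<and> v \<in> half_arc n x} = n div 2"
proof -
  have "{x. x < n \<and> v \<in> half_arc n x} =
      {x. x < n \<and> (int v - int x) mod int n < int (n div 2)}"
    using assms by (auto simp: half_arc_def)
  also have "card \<dots> = card {y. y < n \<and> int y < int (n div 2)}"
    by (rule card_by_offset[OF assms])
  also have "{y. y < n \<and> int y < int (n div 2)} = {..<n div 2}" by auto
  finally show ?thesis by simp
qed

text \<open>Let \<open>y\<close> be the position of \<open>u\<close> relative to the start of the arc, so that \<open>v\<close> has position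
  \<open>y + d\<close>. The arc loses \<open>v\<close> for the last \<open>d\<close> positions \<open>y\<close> inside it, and gains \<open>v\<close> for the last
  \<open>d\<close> positions of the whole cycle, where \<open>y + d\<close> wraps around. The hypothesis
  \<open>d \<le> n div 2\<close> keeps the wrapped position inside the arc and the two ranges disjoint.\<close>

lemma card_half_arcs_separating_near:
  assumes "u < n" "v < n" and d: "(int v - int u) mod int n = int d" "d \<le> n div 2"
  shows "card {x. x < n \<and> (u \<in> half_arc n x) \<noteq> (v \<in> half_arc n x)} = 2 * d"
proof -
  let ?m = "int (n div 2)"
  have shift: "(int v - int x) mod int n = ((int u - int x) mod int n + int d) mod int n" for x
  proof -
    have "((int u - int x) mod int n + int d) mod int n
        = (int u - int x + (int v - int u)) mod int n"
      unfolding d(1)[symmetric] by (simp only: mod_simps)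
    then show ?thesis by simp
  qed
  have offset: "{x. x < n \<and> (u \<in> half_arc n x) \<noteq> (v \<in> half_arc n x)} =
    {x. x < n \<and> ((int u - int x) mod int n < ?m) \<noteq>
       (((int u - int x) mod int n + int d) mod int n < ?m)}"
    using assms(1,2) unfolding half_arc_def mem_Collect_eq shift by blast
  have "{y. y < n \<and> (int y < ?m) \<noteq> ((int y + int d) mod int n < ?m)} =
      {n div 2 - d..<n div 2} \<union> {n - d..<n}"
  proof (rule set_eqI)
    fix y
    have "(int y + int d) mod int n = (if y + d < n then int y + int d else int y + int d - int n)"
      if "y < n"
    proof (cases "y + d < n")
      case False
      have "(int y + int d) mod int n = (int y + int d - int n) mod int n" by simp
      also have "\<dots> = int y + int d - int n"
        using that d(2) False by (intro mod_pos_pos_trivial) auto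
      finally show ?thesis using False by simp
    qed simp
    then have wrap: "y < n \<Longrightarrow> (int y + int d) mod int n < ?m \<longleftrightarrow>
        (if y + d < n then y + d < n div 2 else y + d < n div 2 + n)"
      by auto
    have "y < n \<and> (y < n div 2) \<noteq> (if y + d < n then y + d < n div 2 else y + d < n div 2 + n)
      \<longleftrightarrow> (n div 2 - d \<le> y \<and> y < n div 2) \<or> (n - d \<le> y \<and> y < n)"
      using d(2) by (auto split: if_splits)
    then show "y \<in> {y. y < n \<and> (int y < ?m) \<noteq> ((int y + int d) mod int n < ?m)} \<longleftrightarrow>
        y \<in> {n div 2 - d..<n div 2} \<union> {n - d..<n}"
      using wrap by auto
  qed
  then have "card {x. x < n \<and> (u \<in> half_arc n x) \<noteq> (v \<in> half_arc n x)} =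
      card ({n div 2 - d..<n div 2} \<union> {n - d..<n})"
    unfolding offset
    using card_by_offset[OF assms(1), of "\<lambda>z. (z < ?m) \<noteq> ((z + int d) mod int n < ?m)"]
    by simp
  also have "\<dots> = card {n div 2 - d..<n div 2} + card {n - d..<n}"
    using d(2) by (intro card_Un_disjoint) auto
  also have "\<dots> = 2 * d" using d(2) by simp
  finally show ?thesis .
qed

text \<open>This expresses the distance as a sum of cuts: up to the factor 2, the cycle metric counts
  the half arcs that separate two vertices. Of the two directed offsets, the smaller one is at most
  \<open>n div 2\<close>, so one order of the vertices falls under the previous lemma.\<close>

lemma card_half_arcs_separating:
  assumes "u < n" "v < n"
  shows "card {x. x < n \<and> (u \<in> half_arc n x) \<noteq> (v \<in> half_arc n x)} =
    2 * graph_dist (cycle_graph n) u v"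
proof -
  have near: "card {x. x < n \<and> (a \<in> half_arc n x) \<noteq> (b \<in> half_arc n x)} =
      2 * graph_dist (cycle_graph n) a b"
    if ab: "a < n" "b < n" "(int b - int a) mod int n \<le> (int a - int b) mod int n" for a b
  proof -
    define d where "d = nat ((int b - int a) mod int n)"
    have d: "(int b - int a) mod int n = int d" using ab by (simp add: d_def)
    have "(int a - int b) mod int n = - (int b - int a) mod int n" by simp
    also have "\<dots> = (if d = 0 then 0 else int n - int d)"
      by (simp only: zmod_zminus1_eq_if d) auto
    finally have "d \<le> n div 2" using ab(3) d by (auto split: if_splits)
    from card_half_arcs_separating_near[OF ab(1,2) d this] show ?thesis
      using graph_dist_cycle_graph[OF ab(1,2)] ab(3) d by simp
  qed
  have "{x. x < n \<and> (u \<in> half_arc n x) \<noteq> (v \<in> half_arc n x)} =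
      {x. x < n \<and> (v \<in> half_arc n x) \<noteq> (u \<in> half_arc n x)}" by auto
  then show ?thesis
    using near[OF assms] near[OF assms(2,1)]
      graph_dist_commute[OF pair_graph_cycle_graph, of n u v] by (metis linear)
qed

text \<open>Ordered pairs are easier to sum over than two-element sets.\<close>

lemma wiener_double_sum:
  assumes G: "pair_graph G" and "finite A" "A \<subseteq> pverts G"
  shows "(\<Sum>u\<in>A. \<Sum>v\<in>A. graph_dist G u v) = 2 * wiener G A"
proof -
  interpret pair_graph G by fact
  have self: "graph_dist G u u = 0" if "u \<in> pverts G" for u
    using graph_dist_le_length[of u "[]" u] that by (simp add: awalk_Nil_iff)
  show ?thesis
    using assms(2,3)
  proof (induction A rule: finite_induct)
    case empty
    have none: "{e :: 'a set. e \<subseteq> {} \<and> card e = 2} = {}" by auto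
    show ?case unfolding wiener_def none by simp
  next
    case (insert x A)
    let ?E = "\<lambda>A. {e. e \<subseteq> A \<and> card e = 2}"
    have "?E (insert x A) = ?E A \<union> (\<lambda>v. {x, v}) ` A"
    proof (rule set_eqI)
      fix e
      show "e \<in> ?E (insert x A) \<longleftrightarrow> e \<in> ?E A \<union> (\<lambda>v. {x, v}) ` A"
      proof (cases "x \<in> e")
        case True
        then have "card e = 2 \<longleftrightarrow> (\<exists>v. v \<noteq> x \<and> e = {x, v})"
          unfolding card_2_iff by (auto simp: insert_commute)
        then show ?thesis using True insert.hyps by auto
      next
        case False
        then show ?thesis by auto
      qed
    qed
    moreover have "?E A \<inter> (\<lambda>v. {x, v}) ` A = {}" using insert.hyps by auto
    moreover have "finite (?E A)" using insert.hyps by simp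
    moreover have "inj_on (\<lambda>v. {x, v}) A" by (auto simp: inj_on_def doubleton_eq_iff)
    ultimately have "wiener G (insert x A) = wiener G A + (\<Sum>v\<in>A. graph_dist G x v)"
      using insert.hyps
      by (simp add: wiener_def sum.union_disjoint sum.reindex pair_dist_insert[OF G])
    moreover have "(\<Sum>u\<in>insert x A. \<Sum>v\<in>insert x A. graph_dist G u v) =
        2 * (\<Sum>v\<in>A. graph_dist G x v) + (\<Sum>u\<in>A. \<Sum>v\<in>A. graph_dist G u v)"
    proof -
      have "(\<Sum>u\<in>A. graph_dist G u x) = (\<Sum>v\<in>A. graph_dist G x v)"
        by (intro sum.cong graph_dist_commute[OF G]) simp
      then show ?thesis
        using insert.hyps insert.prems by (simp add: sum.distrib self)
    qed
    ultimately show ?case using insert.IH insert.prems by simp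
  qed
qed

lemma sum_separated_pairs:
  fixes A H :: "'a set"
  assumes "finite A"
  shows "(\<Sum>u\<in>A. \<Sum>v\<in>A. of_bool ((u \<in> H) \<noteq> (v \<in> H))) =
    2 * int (card (A \<inter> H)) * (int (card A) - int (card (A \<inter> H)))"
proof -
  have c: "(\<Sum>u\<in>A. of_bool (u \<in> H)) = int (card (A \<inter> H))"
    using assms by simp
  have "(\<Sum>u\<in>A. \<Sum>v\<in>A. of_bool ((u \<in> H) \<noteq> (v \<in> H))) =
     (\<Sum>u\<in>A. \<Sum>v\<in>A. of_bool (u \<in> H) + of_bool (v \<in> H)
        - 2 * (of_bool (u \<in> H) * of_bool (v \<in> H)) :: int)"
    by (intro sum.cong) auto
  also have "\<dots> = (\<Sum>u\<in>A. int (card A) * of_bool (u \<in> H) + int (card (A \<inter> H))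
        - 2 * (of_bool (u \<in> H) * int (card (A \<inter> H))))"
    by (simp only: sum.distrib sum_subtractf sum_distrib_left[symmetric] c sum_constant)
  also have "\<dots> = int (card A) * int (card (A \<inter> H)) + int (card A) * int (card (A \<inter> H))
        - 2 * (int (card (A \<inter> H)) * int (card (A \<inter> H)))"
    by (simp only: sum.distrib sum_subtractf sum_distrib_left[symmetric]
        sum_distrib_right[symmetric] c sum_constant)
  finally show ?thesis by (simp add: algebra_simps)
qed

lemma wiener_half_arcs:
  assumes "A \<subseteq> {0..<n}"
  shows "2 * int (wiener (cycle_graph n) A) =
    (\<Sum>x<n. int (card (A \<inter> half_arc n x)) * (int (card A) - int (card (A \<inter> half_arc n x))))"
proof -
  have fin: "finite A" using assms finite_subset by blast
  have sep: "2 * int (graph_dist (cycle_graph n) u v) =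
      (\<Sum>x<n. of_bool ((u \<in> half_arc n x) \<noteq> (v \<in> half_arc n x)))"
    if "u \<in> A" "v \<in> A" for u v
  proof -
    have "{..<n} \<inter> {x. (u \<in> half_arc n x) \<noteq> (v \<in> half_arc n x)} =
        {x. x < n \<and> (u \<in> half_arc n x) \<noteq> (v \<in> half_arc n x)}" by auto
    moreover have "u < n" "v < n" using that assms by auto
    ultimately show ?thesis using card_half_arcs_separating[of u n v] by simp
  qed
  have "4 * int (wiener (cycle_graph n) A) =
      2 * int (\<Sum>u\<in>A. \<Sum>v\<in>A. graph_dist (cycle_graph n) u v)"
    using wiener_double_sum[OF pair_graph_cycle_graph fin] assms by simp
  also have "\<dots> = (\<Sum>u\<in>A. \<Sum>v\<in>A. \<Sum>x<n.
      of_bool ((u \<in> half_arc n x) \<noteq> (v \<in> half_arc n x)))"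
    unfolding of_nat_sum sum_distrib_left by (intro sum.cong sep) auto
  also have "\<dots> = (\<Sum>u\<in>A. \<Sum>x<n. \<Sum>v\<in>A.
      of_bool ((u \<in> half_arc n x) \<noteq> (v \<in> half_arc n x)))"
    by (intro sum.cong sum.swap refl)
  also have "\<dots> = (\<Sum>x<n. \<Sum>u\<in>A. \<Sum>v\<in>A.
      of_bool ((u \<in> half_arc n x) \<noteq> (v \<in> half_arc n x)))"
    by (rule sum.swap)
  also have "\<dots> = 2 * (\<Sum>x<n. int (card (A \<inter> half_arc n x)) *
      (int (card A) - int (card (A \<inter> half_arc n x))))"
    by (simp only: sum_separated_pairs[OF fin] sum_distrib_left mult.assoc)
  finally show ?thesis by simp
qed

lemma sum_card_Int_half_arc:
  assumes "A \<subseteq> {0..<n}"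
  shows "(\<Sum>x<n. card (A \<inter> half_arc n x)) = (n div 2) * card A"
proof -
  have fin: "finite A" using assms finite_subset by blast
  have "(\<Sum>x<n. card (A \<inter> half_arc n x)) = (\<Sum>x<n. \<Sum>v\<in>A. of_bool (v \<in> half_arc n x))"
    using fin by simp
  also have "\<dots> = (\<Sum>v\<in>A. \<Sum>x<n. of_bool (v \<in> half_arc n x))" by (rule sum.swap)
  also have "\<dots> = (\<Sum>v\<in>A. n div 2)"
  proof (rule sum.cong)
    fix v assume "v \<in> A"
    then have "v < n" using assms by auto
    moreover have "{..<n} \<inter> {x. v \<in> half_arc n x} = {x. x < n \<and> v \<in> half_arc n x}" by auto
    ultimately show "(\<Sum>x<n. of_bool (v \<in> half_arc n x)) = n div 2"
      using card_half_arcs_containing[of v n] by simp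
  qed simp
  finally show ?thesis by simp
qed

text \<open>A set is balanced if every half arc meets it in nearly half of its elements, with rounding
  chosen to cover all parities at once: for \<open>card A = 2 * b\<close> the counts are \<open>b\<close> and \<open>b - 1\<close>, and
  for \<open>card A = 2 * b + 1\<close> they are \<open>b + 1\<close> and \<open>b\<close>. The slack below \<open>b\<close> in the even case is
  unavoidable for odd \<open>n\<close>, since half arcs then have fewer than half of the vertices.\<close>

definition balanced :: "nat \<Rightarrow> nat set \<Rightarrow> bool" where
  "balanced n A \<longleftrightarrow> A \<subseteq> {0..<n} \<and>
     (\<forall>x<n. card (A \<inter> half_arc n x) \<in> {(card A + 1) div 2, (card A + 1) div 2 - 1})"

text \<open>The terms \<open>c * (a - c)\<close> and \<open>(c - q) * (c - q + 1)\<close> have opposite quadratic parts in \<open>c\<close>.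
  Their sum is linear in \<open>c\<close>, and the sum of the counts \<open>c\<close> over all half arcs depends only on
  the size of the set.\<close>

lemma wiener_plus_imbalance:
  fixes n :: nat and A :: "nat set"
  defines "a \<equiv> int (card A)" and "q \<equiv> int ((card A + 1) div 2)"
  assumes "A \<subseteq> {0..<n}"
  shows "2 * int (wiener (cycle_graph n) A)
    + (\<Sum>x<n. (int (card (A \<inter> half_arc n x)) - q) * (int (card (A \<inter> half_arc n x)) - q + 1))
    = (a + 1 - 2 * q) * (int (n div 2) * a) + int n * (q * (q - 1))"
proof -
  let ?c = "\<lambda>x. int (card (A \<inter> half_arc n x))"
  have "2 * int (wiener (cycle_graph n) A) + (\<Sum>x<n. (?c x - q) * (?c x - q + 1)) =
      (\<Sum>x<n. ?c x * (a - ?c x) + (?c x - q) * (?c x - q + 1))"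
    unfolding wiener_half_arcs[OF assms(3)] a_def sum.distrib ..
  also have "\<dots> = (\<Sum>x<n. (a + 1 - 2 * q) * ?c x + q * (q - 1))"
    by (intro sum.cong) (auto simp: algebra_simps)
  also have "\<dots> = (a + 1 - 2 * q) * int (\<Sum>x<n. card (A \<inter> half_arc n x)) + int n * (q * (q - 1))"
    by (simp add: sum.distrib sum_distrib_left)
  finally show ?thesis
    unfolding sum_card_Int_half_arc[OF assms(3)] a_def by simp
qed

text \<open>The imbalance is a sum of products of consecutive integers, hence nonnegative; it vanishes
  exactly when all counts are \<open>q\<close> or \<open>q - 1\<close>.\<close>

lemma balanced_wiener_ge:
  assumes "balanced n A" "B \<subseteq> {0..<n}" "card B = card A"
  shows "wiener (cycle_graph n) B \<le> wiener (cycle_graph n) A"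
proof -
  define q where "q = (card A + 1) div 2"
  let ?s = "\<lambda>A x. (int (card (A \<inter> half_arc n x)) - int q) *
    (int (card (A \<inter> half_arc n x)) - int q + 1)"
  have A: "A \<subseteq> {0..<n}" using assms(1) by (simp add: balanced_def)
  have nonneg: "z * (z + 1) \<ge> 0" for z :: int
    by (cases "z \<ge> 0") (auto intro: mult_nonneg_nonneg mult_nonpos_nonpos)
  have "?s A x = 0" if "x < n" for x
  proof -
    have "card (A \<inter> half_arc n x) \<in> {q, q - 1}"
      using assms(1) that by (simp add: balanced_def q_def)
    moreover have "q = 0 \<Longrightarrow> card (A \<inter> half_arc n x) = 0"
      using calculation by simp
    ultimately show ?thesis by (cases "q = 0") (auto simp: of_nat_diff)
  qed
  then have "(\<Sum>x<n. ?s A x) = 0" by (intro sum.neutral) blast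
  moreover have "(\<Sum>x<n. ?s B x) \<ge> 0" by (intro sum_nonneg nonneg)
  ultimately show ?thesis
    using wiener_plus_imbalance[OF A, folded q_def]
      wiener_plus_imbalance[OF assms(2), unfolded assms(3), folded q_def]
    by linarith
qed

section \<open>The zigzag order\<close>

text \<open>The order \<open>0, m, -1, m - 1, -2, m - 2, \<dots>\<close> modulo \<open>n\<close> with \<open>m = n div 2\<close>: positions
  \<open>2 * i\<close> and \<open>2 * i + 1\<close> carry the nearly antipodal vertices \<open>- i\<close> and \<open>m - i\<close>.\<close>

definition zigzag :: "nat \<Rightarrow> nat \<Rightarrow> nat" where
  "zigzag n j = nat ((int (n div 2) * int (j mod 2) - int (j div 2)) mod int n)"

lemma int_zigzag:
  "n > 0 \<Longrightarrow> int (zigzag n j) = (int (n div 2) * int (j mod 2) - int (j div 2)) mod int n"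
  by (simp add: zigzag_def)

lemma zigzag_less: "n > 0 \<Longrightarrow> zigzag n j < n"
  by (simp add: zigzag_def nat_less_iff)

lemma inj_on_zigzag: "inj_on (zigzag n) {0..<n}"
proof (rule inj_onI)
  fix j k assume "j \<in> {0..<n}" "k \<in> {0..<n}" and eq: "zigzag n j = zigzag n k"
  then have jk: "j < n" "k < n" and n: "n > 0" by auto
  define D where "D = int (n div 2) * int (j mod 2) - int (j div 2)
      - (int (n div 2) * int (k mod 2) - int (k div 2))"
  have "int n dvd D"
    using eq int_zigzag[OF n] unfolding D_def
    by (metis mod_eq_dvd_iff)
  moreover have "\<bar>D\<bar> < int n"
    using jk unfolding D_def by (cases "even j"; cases "even k") (auto elim!: evenE oddE)
  ultimately have "D = 0" using dvd_imp_le_int[of D "int n"] by fastforce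
  then show "j = k"
    using jk unfolding D_def by (cases "even j"; cases "even k") (auto elim!: evenE oddE)
qed

lemma bij_betw_zigzag: "bij_betw (zigzag n) {0..<n} {0..<n}"
proof -
  have "zigzag n ` {0..<n} \<subseteq> {0..<n}" by (auto intro!: zigzag_less)
  then have "zigzag n ` {0..<n} = {0..<n}"
    by (intro card_subset_eq) (auto simp: card_image inj_on_zigzag)
  then show ?thesis by (simp add: bij_betw_def inj_on_zigzag)
qed

text \<open>From an odd to the next even position the order moves by \<open>- (m + 1)\<close>, which agrees with \<open>m\<close>
  modulo \<open>n\<close> if \<open>n = 2 * m + 1\<close>. For odd \<open>n\<close> the list thus repeatedly adds \<open>m\<close>, and the parity of
  positions does not matter.\<close>

lemma zigzag_Suc:
  assumes "n > 0" "odd n \<or> even j"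
  shows "[int (zigzag n (Suc j)) - int (zigzag n j) = int (n div 2)] (mod int n)"
proof -
  have "int (n div 2) * int (Suc j mod 2) - int (Suc j div 2)
      - (int (n div 2) * int (j mod 2) - int (j div 2)) =
      int (n div 2) - int n * of_bool (odd j)"
  proof (cases "even j")
    case True
    then show ?thesis by (auto elim!: evenE)
  next
    case False
    then have "odd n" using assms(2) by simp
    then obtain m where m: "n = 2 * m + 1" by (elim oddE)
    have "j mod 2 = 1" "Suc j mod 2 = 0" "Suc j div 2 = Suc (j div 2)"
      using False by presburger+
    moreover have "n div 2 = m" using m by simp
    ultimately show ?thesis using False m by simp
  qed
  then show ?thesis
    by (simp add: int_zigzag[OF assms(1)] cong_def mod_simps mod_mult_self2)
qed

text \<open>For even \<open>n\<close> a half arc and its antipodal image partition the cycle. For odd \<open>n\<close> the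
  half arc \<open>{x..<x + m}\<close> and its translate by \<open>- m\<close> miss one vertex, \<open>x + m\<close>.\<close>

lemma half_arc_near_antipodal:
  assumes "x < n" "v < n" "w < n" "[int w - int v = int (n div 2)] (mod int n)"
  shows "of_bool (v \<in> half_arc n x) + of_bool (w \<in> half_arc n x) =
    (of_bool (\<not> (odd n \<and> v = (x + n div 2) mod n)) :: nat)"
proof -
  define y where "y = (int v - int x) mod int n"
  have y: "0 \<le> y" "y < int n" using assms by (simp_all add: y_def)
  have "(int w - int x) mod int n = ((int w - int v) + (int v - int x)) mod int n" by simp
  also have "\<dots> = (int (n div 2) + y) mod int n"
    using assms(4) unfolding y_def cong_def by (metis mod_add_cong mod_mod_trivial)
  also have "\<dots> = (if y + int (n div 2) < int n then y + int (n div 2)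
      else y + int (n div 2) - int n)"
  proof (cases "y + int (n div 2) < int n")
    case False
    have "(int (n div 2) + y) mod int n = (y + int (n div 2) - int n) mod int n"
      by (simp add: add.commute)
    also have "\<dots> = y + int (n div 2) - int n"
      using y False by (intro mod_pos_pos_trivial) auto
    finally show ?thesis using False by simp
  qed (use y in \<open>simp add: add.commute\<close>)
  finally have w: "(int w - int x) mod int n = \<dots>" .
  have "v = (x + n div 2) mod n \<longleftrightarrow> y = int (n div 2)"
  proof -
    have "v = (x + n div 2) mod n \<longleftrightarrow> int v = (int x + int (n div 2)) mod int n"
      by (metis of_nat_add of_nat_eq_iff zmod_int)
    also have "\<dots> \<longleftrightarrow> int v mod int n = (int x + int (n div 2)) mod int n"
      using assms(2) by simp
    also have "\<dots> \<longleftrightarrow> y = int (n div 2) mod int n"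
      unfolding y_def by (simp add: mod_eq_dvd_iff algebra_simps)
    finally show ?thesis using assms by simp
  qed
  moreover have "v \<in> half_arc n x \<longleftrightarrow> y < int (n div 2)"
    using assms(2) by (simp add: half_arc_def y_def)
  moreover have "w \<in> half_arc n x \<longleftrightarrow> (if y + int (n div 2) < int n then y + int (n div 2)
      else y + int (n div 2) - int n) < int (n div 2)"
    using assms(3) unfolding half_arc_def by (simp add: w)
  moreover obtain m where "n div 2 = m" "n = 2 * m \<and> even n \<or> n = 2 * m + 1 \<and> odd n"
    by (cases "even n") (auto elim!: evenE oddE)
  ultimately show ?thesis
    using y by (cases "y < int m"; cases "y + int m < int n") auto
qed

text \<open>In its applications \<open>b\<close> indicates which positions of the zigzag order carry vertices of a
  given half arc, and \<open>p\<close> is the position, if any, where two neighbours are both missed.\<close>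

lemma sum_pairs_one_defect:
  fixes b :: "nat \<Rightarrow> nat"
  assumes "\<And>i. i < k \<Longrightarrow> b (s + 2 * i) + b (Suc (s + 2 * i)) = of_bool (s + 2 * i \<noteq> p)"
  shows "(\<Sum>j\<in>{s..<s + 2 * k}. b j) + of_bool (\<exists>i<k. s + 2 * i = p) = k"
  using assms
proof (induction k)
  case (Suc k)
  have "{s..<s + 2 * Suc k} = insert (Suc (s + 2 * k)) (insert (s + 2 * k) {s..<s + 2 * k})"
    by auto
  then have "(\<Sum>j\<in>{s..<s + 2 * Suc k}. b j) =
      (\<Sum>j\<in>{s..<s + 2 * k}. b j) + of_bool (s + 2 * k \<noteq> p)"
    using Suc.prems[of k] by simp
  moreover have "(\<Sum>j\<in>{s..<s + 2 * k}. b j) + of_bool (\<exists>i<k. s + 2 * i = p) = k"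
    using Suc.prems by (intro Suc.IH) simp
  moreover have "of_bool (\<exists>i<Suc k. s + 2 * i = p) =
      (of_bool (\<exists>i<k. s + 2 * i = p) + of_bool (s + 2 * k = p) :: nat)"
    by (auto simp: less_Suc_eq)
  ultimately show ?case by (cases "s + 2 * k = p") simp_all
qed simp

text \<open>\<open>E\<close> states that pairs may start at any position; otherwise they start at even positions, and
  \<open>p\<close> lies beyond the interval, which means that no pair is defective. An interval of odd length
  leaves one position over after pairing, and it may be the first or the last one. The two pairings
  use positions of different parities, so the defect \<open>p\<close> spoils at most one of them; with
  the other one, the sum is the number of pairs plus the contribution of a single position.\<close>

lemma sum_interval_one_defect:
  fixes b :: "nat \<Rightarrow> nat"
  assumes pair: "\<And>j. s \<le> j \<Longrightarrow> Suc j < s + a \<Longrightarrow> E \<or> even j \<Longrightarrow>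
      b j + b (Suc j) = of_bool (j \<noteq> p)"
    and le1: "\<And>j. b j \<le> 1"
    and start: "E \<or> odd a \<or> even s"
    and defect: "E \<or> s + a \<le> p"
  shows "(\<Sum>j\<in>{s..<s + a}. b j) \<in> {(a + 1) div 2, (a + 1) div 2 - 1}"
proof (cases "even a")
  case True
  then obtain k where k: "a = 2 * k" by blast
  have "(\<Sum>j\<in>{s..<s + 2 * k}. b j) + of_bool (\<exists>i<k. s + 2 * i = p) = k"
    using start True by (intro sum_pairs_one_defect pair) (auto simp: k)
  then show ?thesis using k by (cases "\<exists>i<k. s + 2 * i = p") auto
next
  case False
  then obtain k where k: "a = 2 * k + 1" by (elim oddE)
  have last: ?thesis if "E \<or> even s" "\<not> (\<exists>i<k. s + 2 * i = p)"
  proof -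
    have "(\<Sum>j\<in>{s..<s + 2 * k}. b j) + of_bool (\<exists>i<k. s + 2 * i = p) = k"
      using that by (intro sum_pairs_one_defect pair) (auto simp: k)
    moreover have "{s..<s + a} = insert (s + 2 * k) {s..<s + 2 * k}" by (auto simp: k)
    ultimately show ?thesis using that(2) le1[of "s + 2 * k"] by (auto simp: k)
  qed
  have first: ?thesis if "E \<or> odd s" "\<not> (\<exists>i<k. Suc s + 2 * i = p)"
  proof -
    have "(\<Sum>j\<in>{Suc s..<Suc s + 2 * k}. b j) + of_bool (\<exists>i<k. Suc s + 2 * i = p) = k"
      using that by (intro sum_pairs_one_defect pair) (auto simp: k)
    moreover have "of_bool (\<exists>i<k. Suc s + 2 * i = p) = (0 :: nat)" using that(2) by auto
    ultimately have "(\<Sum>j\<in>{Suc s..<Suc s + 2 * k}. b j) = k" by linarith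
    moreover have "(\<Sum>j\<in>{s..<s + a}. b j) = b s + (\<Sum>j\<in>{Suc s..<Suc s + 2 * k}. b j)"
      by (simp add: k sum.atLeast_Suc_lessThan)
    ultimately show ?thesis using le1[of s] by (auto simp: k le_Suc_eq)
  qed
  have "\<not> (\<exists>i<k. s + 2 * i = p) \<or> \<not> (\<exists>i<k. Suc s + 2 * i = p)" by presburger
  moreover have "\<not> (\<exists>i<k. s + 2 * i = p) \<and> \<not> (\<exists>i<k. Suc s + 2 * i = p)" if "\<not> E"
    using that defect k by auto
  ultimately show ?thesis using first last by blast
qed

lemma balanced_zigzag_interval:
  assumes "s + a \<le> n" "odd n \<or> odd a \<or> even s"
  shows "balanced n (zigzag n ` {s..<s + a})"
proof -
  let ?A = "zigzag n ` {s..<s + a}"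
  have inj: "inj_on (zigzag n) {s..<s + a}"
    using inj_on_zigzag by (rule inj_on_subset) (use assms in auto)
  then have card: "card ?A = a" by (simp add: card_image)
  have sub: "?A \<subseteq> {0..<n}" using assms(1) by (auto intro!: zigzag_less)
  have "card (?A \<inter> half_arc n x) \<in> {(a + 1) div 2, (a + 1) div 2 - 1}" if x: "x < n" for x
  proof -
    have n: "n > 0" using x by simp
    let ?b = "\<lambda>j. of_bool (zigzag n j \<in> half_arc n x) :: nat"
    have "card (?A \<inter> half_arc n x) = (\<Sum>v\<in>?A. of_bool (v \<in> half_arc n x))" by simp
    also have "\<dots> = (\<Sum>j\<in>{s..<s + a}. ?b j)" by (simp only: sum.reindex[OF inj] comp_def)
    finally have sum: "card (?A \<inter> half_arc n x) = (\<Sum>j\<in>{s..<s + a}. ?b j)" .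
    have "(x + n div 2) mod n \<in> zigzag n ` {0..<n}"
      using bij_betw_zigzag[of n] n by (simp add: bij_betw_def)
    then obtain t where t: "t < n" "zigzag n t = (x + n div 2) mod n" by auto
    \<comment> \<open>For even \<open>n\<close> no pair is missed, and \<open>n\<close> serves as a position beyond the interval.\<close>
    define p where "p = (if odd n then t else n)"
    have pair: "?b j + ?b (Suc j) = of_bool (j \<noteq> p)"
      if "Suc j < s + a" "odd n \<or> even j" for j
    proof -
      have j: "j < n" using that assms by simp
      have "zigzag n j = (x + n div 2) mod n \<longleftrightarrow> j = t"
        using t j inj_on_zigzag[of n] by (auto simp: inj_on_def)
      then show ?thesis
        using half_arc_near_antipodal[OF x zigzag_less zigzag_less zigzag_Suc, of j] n that j
        by (auto simp: p_def)
    qed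
    show ?thesis unfolding sum
      by (rule sum_interval_one_defect[where E = "odd n" and p = p])
        (use pair assms in \<open>auto simp: p_def\<close>)
  qed
  then show ?thesis using sub by (simp add: balanced_def card)
qed

section \<open>Colorings with prescribed class sizes\<close>

text \<open>The zigzag order is cut into consecutive blocks, one for each color, with the blocks of even
  size first. Every block of even size is then preceded by even sizes only and starts at an even
  position, as needed for even \<open>n\<close>.\<close>

lemma balanced_coloring_exists:
  fixes sz :: "nat \<Rightarrow> nat"
  assumes "(\<Sum>i=1..k. sz i) = n"
  obtains g where "\<And>v. v < n \<Longrightarrow> g v \<in> {1..k}"
    and "\<And>i. i \<in> {1..k} \<Longrightarrow> balanced n (color_class (cycle_graph n) g i)"
    and "\<And>i. i \<in> {1..k} \<Longrightarrow> card (color_class (cycle_graph n) g i) = sz i"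
proof -
  define ev od where "ev = filter (\<lambda>i. even (sz i)) [1..<Suc k]"
    and "od = filter (\<lambda>i. odd (sz i)) [1..<Suc k]"
  define blocks where "blocks cs = concat (map (\<lambda>i. replicate (sz i) i) cs)" for cs
  define L where "L = blocks (ev @ od)"
  have set_cs: "set (ev @ od) = {1..k}" unfolding ev_def od_def by auto
  have dist: "distinct (ev @ od)" unfolding ev_def od_def by auto
  have append: "blocks (xs @ ys) = blocks xs @ blocks ys"
    and Cons: "blocks (i # ys) = replicate (sz i) i @ blocks ys"
    and set: "set (blocks xs) \<subseteq> set xs"
    and len: "length (blocks xs) = sum_list (map sz xs)" for xs ys i
    unfolding blocks_def by (auto simp: length_concat comp_def)
  have length_L: "length L = n"
  proof -
    have "length L = sum_list (map sz (ev @ od))" unfolding L_def len ..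
    also have "\<dots> = (\<Sum>i\<in>set (ev @ od). sz i)" by (rule sum_list_distinct_conv_sum_set[OF dist])
    finally show ?thesis unfolding set_cs using assms by simp
  qed
  define g where "g v = L ! the_inv_into {0..<n} (zigzag n) v" for v
  have g_zigzag: "g (zigzag n j) = L ! j" if "j < n" for j
    unfolding g_def using that by (simp add: the_inv_into_f_f[OF inj_on_zigzag])
  have class_eq: "color_class (cycle_graph n) g i = zigzag n ` {j. j < n \<and> L ! j = i}" for i
  proof -
    have "{0..<n} = zigzag n ` {0..<n}" using bij_betw_zigzag[of n] by (simp add: bij_betw_def)
    then have "color_class (cycle_graph n) g i = {v \<in> zigzag n ` {0..<n}. g v = i}"
      by (simp add: color_class_def)
    then show ?thesis using g_zigzag by auto
  qed
  have interval: "\<exists>s. s + sz i \<le> n \<and> (odd (sz i) \<or> even s) \<and>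
      {j. j < n \<and> L ! j = i} = {s..<s + sz i}" if i: "i \<in> {1..k}" for i
  proof -
    have "\<exists>us vs. ev @ od = us @ i # vs \<and> (odd (sz i) \<or> set us \<subseteq> set ev)"
    proof (cases "even (sz i)")
      case True
      then have "i \<in> set ev" using i by (auto simp: ev_def simp del: upt_Suc)
      then obtain us vs where "ev = us @ i # vs" by (meson split_list)
      then show ?thesis by (intro exI[of _ us] exI[of _ "vs @ od"]) auto
    next
      case False
      moreover have "i \<in> set (ev @ od)" using i set_cs by simp
      ultimately show ?thesis by (meson split_list)
    qed
    then obtain us vs where uv: "ev @ od = us @ i # vs" "odd (sz i) \<or> set us \<subseteq> set ev" by blast
    define s where "s = length (blocks us)"
    have L: "L = blocks us @ replicate (sz i) i @ blocks vs"
      unfolding L_def uv(1) append Cons ..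
    have "i \<notin> set us" "i \<notin> set vs" using dist unfolding uv(1) by auto
    then have notin: "i \<notin> set (blocks us)" "i \<notin> set (blocks vs)" using set by blast+
    have bound: "s + sz i \<le> n" using length_L unfolding L s_def by simp
    have "{j. j < n \<and> L ! j = i} = {s..<s + sz i}"
    proof (rule set_eqI)
      fix j
      have "L ! j \<noteq> i" if "j < s"
        using that notin(1) unfolding L s_def by (auto simp: nth_append)
      moreover have "L ! j = i" if "s \<le> j" "j < s + sz i"
        using that unfolding L s_def by (auto simp: nth_append)
      moreover have "L ! j \<noteq> i" if "s + sz i \<le> j" "j < n"
      proof -
        have "j - s - sz i < length (blocks vs)"
          using that length_L unfolding L s_def by auto
        then have "blocks vs ! (j - s - sz i) \<noteq> i" using notin(2) nth_mem by metis
        moreover have "L ! j = blocks vs ! (j - s - sz i)"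
          using that(1) unfolding L s_def by (auto simp: nth_append)
        ultimately show ?thesis by simp
      qed
      ultimately show "j \<in> {j. j < n \<and> L ! j = i} \<longleftrightarrow> j \<in> {s..<s + sz i}"
        using bound by (cases "j < s"; cases "j < s + sz i") auto
    qed
    moreover have "even s" if "set us \<subseteq> set ev"
    proof -
      have "\<forall>c\<in>set us. even (sz c)" using that by (auto simp: ev_def)
      then show ?thesis unfolding s_def len by (induction us) auto
    qed
    ultimately show ?thesis using uv(2) bound by blast
  qed
  show ?thesis
  proof (rule that)
    fix v assume "v < n"
    then obtain j where "j < n" "v = zigzag n j"
      using bij_betw_imp_surj_on[OF bij_betw_zigzag[of n]] by fastforce
    then have "g v \<in> set L" using g_zigzag length_L by simp
    then show "g v \<in> {1..k}" using set set_cs unfolding L_def by blast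
  next
    fix i assume "i \<in> {1..k}"
    then obtain s where s: "s + sz i \<le> n" "odd (sz i) \<or> even s"
        "{j. j < n \<and> L ! j = i} = {s..<s + sz i}"
      using interval by blast
    show "balanced n (color_class (cycle_graph n) g i)"
      unfolding class_eq s(3) using s by (intro balanced_zigzag_interval) auto
    have "inj_on (zigzag n) {s..<s + sz i}"
      using inj_on_zigzag by (rule inj_on_subset) (use s in auto)
    then show "card (color_class (cycle_graph n) g i) = sz i"
      unfolding class_eq s(3) by (simp add: card_image)
  qed
qed

section \<open>Weak maximizers\<close>

lemma wiener_maximizer_iff:
  assumes "finite (pverts G)"
  shows "wiener_maximizer G A \<longleftrightarrow> A \<subseteq> pverts G \<and>
    (\<forall>B. B \<subseteq> pverts G \<and> card B = card A \<longrightarrow> wiener G B \<le> wiener G A)"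
proof (cases "A \<subseteq> pverts G")
  case True
  let ?S = "{wiener G A' | A'. A' \<subseteq> pverts G \<and> card A' = card A}"
  have "?S \<subseteq> wiener G ` Pow (pverts G)" by auto
  then have "finite ?S" using assms by (meson finite_Pow_iff finite_imageI finite_subset)
  moreover have "wiener G A \<in> ?S" using True by blast
  ultimately have "Max ?S = wiener G A \<longleftrightarrow> (\<forall>w\<in>?S. w \<le> wiener G A)"
    by (subst Max_eq_iff) auto
  then show ?thesis unfolding wiener_maximizer_def using True by auto
qed (simp add: wiener_maximizer_def)

text \<open>The type records the multiset of class sizes, so it determines every sum over the colors of a
  function of the class size.\<close>

lemma sum_colors_cong_type:
  assumes "coloring_type G k f = coloring_type G k f'"
  shows "(\<Sum>i=1..k. F (card (color_class G f i))) = (\<Sum>i=1..k. F (card (color_class G f' i)))"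
proof -
  have "(\<Sum>i=1..k. F (card (color_class G h i))) =
      sum_list (map F (map (\<lambda>i. card (color_class G h i)) [1..<Suc k]))" for h
  proof -
    have "{1..k} = set [1..<Suc k]" by auto
    then show ?thesis by (simp add: sum_list_distinct_conv_sum_set comp_def del: upt_Suc)
  qed
  moreover have "sum_list (map F xs) = sum_list (map F ys)" if "mset xs = mset ys" for xs ys
    using that by (metis mset_map sum_mset_sum_list)
  moreover have "mset (map (\<lambda>i. card (color_class G f i)) [1..<Suc k]) =
      mset (map (\<lambda>i. card (color_class G f' i)) [1..<Suc k])"
    using assms unfolding coloring_type_def by (metis mset_sort)
  ultimately show ?thesis by metis
qed

lemma sum_card_color_class:
  assumes "finite (pverts G)" "surj_coloring G k f"
  shows "(\<Sum>i=1..k. card (color_class G f i)) = card (pverts G)"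
proof -
  have "card (pverts G) = (\<Sum>i\<in>{1..k}. card {v \<in> pverts G. f v = i})"
    using assms sum.group[of "pverts G" "{1..k}" f "\<lambda>_. 1 :: nat"]
    by (simp add: surj_coloring_def)
  then show ?thesis by (simp add: color_class_def)
qed

theorem theorem2p8:
  fixes n k :: nat and f :: "nat \<Rightarrow> nat"
  assumes "n > 0" and "k \<ge> 2" and "surj_coloring (cycle_graph n) k f"
  shows "weak_maximizer (cycle_graph n) k f \<longleftrightarrow>
    (\<forall>i \<in> {1..k}. wiener_maximizer (cycle_graph n) (color_class (cycle_graph n) f i))"
proof
  let ?G = "cycle_graph n"
  assume weak: "weak_maximizer ?G k f"
  have "(\<Sum>i=1..k. card (color_class ?G f i)) = n"
    using sum_card_color_class[OF _ assms(3)] by simp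
  then obtain g where g: "\<And>v. v < n \<Longrightarrow> g v \<in> {1..k}"
    "\<And>i. i \<in> {1..k} \<Longrightarrow> balanced n (color_class ?G g i)"
    "\<And>i. i \<in> {1..k} \<Longrightarrow> card (color_class ?G g i) = card (color_class ?G f i)"
    using balanced_coloring_exists by metis
  \<comment> \<open>Surjectivity transfers from \<open>f\<close> because the class sizes agree and those of \<open>f\<close> are positive.\<close>
  have "surj_coloring ?G k g"
  proof -
    have "i \<in> g ` pverts ?G" if i: "i \<in> {1..k}" for i
    proof -
      have "color_class ?G f i \<noteq> {}"
      proof -
        have "i \<in> f ` pverts ?G" using assms(3) i by (simp add: surj_coloring_def)
        then show ?thesis by (auto simp: color_class_def)
      qed
      then have "card (color_class ?G f i) \<noteq> 0"
        by (simp add: color_class_def)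
      then have "color_class ?G g i \<noteq> {}" using g(3)[OF i] by auto
      then show ?thesis by (auto simp: color_class_def)
    qed
    then show ?thesis using g(1) by (auto simp: surj_coloring_def)
  qed
  moreover have "coloring_type ?G k g = coloring_type ?G k f"
    unfolding coloring_type_def using g(3)
    by (intro arg_cong[where f = sort] map_cong) auto
  ultimately have ge: "coloring_wiener ?G k g \<le> coloring_wiener ?G k f"
    using weak by (simp add: weak_maximizer_def)
  have le: "wiener ?G B \<le> wiener ?G (color_class ?G g i)"
    if "i \<in> {1..k}" "B \<subseteq> {0..<n}" "card B = card (color_class ?G f i)" for i B
    using balanced_wiener_ge[OF g(2)] g(3) that by simp
  have sub: "color_class ?G f i \<subseteq> {0..<n}" for i by (auto simp: color_class_def)
  show "\<forall>i \<in> {1..k}. wiener_maximizer ?G (color_class ?G f i)"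
  proof
    fix i assume i: "i \<in> {1..k}"
    have "coloring_wiener ?G k f = coloring_wiener ?G k g"
      using ge
    proof (rule antisym[rotated])
      show "coloring_wiener ?G k f \<le> coloring_wiener ?G k g"
        unfolding coloring_wiener_def using le sub by (intro sum_mono) simp
    qed
    then have "wiener ?G (color_class ?G f i) = wiener ?G (color_class ?G g i)"
      unfolding coloring_wiener_def by (rule sum_mono_inv) (use le sub i in auto)
    then show "wiener_maximizer ?G (color_class ?G f i)"
      using le i sub by (simp add: wiener_maximizer_iff)
  qed
next
  let ?G = "cycle_graph n"
  assume max: "\<forall>i \<in> {1..k}. wiener_maximizer ?G (color_class ?G f i)"
  \<comment> \<open>The best value for one class, as a function of its size alone.\<close>
  define opt where "opt a = Max {wiener ?G A | A. A \<subseteq> pverts ?G \<and> card A = a}" for a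
  have "coloring_wiener ?G k f' \<le> coloring_wiener ?G k f"
    if type: "coloring_type ?G k f' = coloring_type ?G k f" for f'
  proof -
    have opt: "wiener ?G A \<le> opt (card A)" if "A \<subseteq> {0..<n}" for A
    proof -
      let ?S = "{wiener ?G B | B. B \<subseteq> pverts ?G \<and> card B = card A}"
      have "?S \<subseteq> wiener ?G ` Pow {0..<n}" by auto
      then have "finite ?S" by (meson finite_Pow_iff finite_atLeastLessThan finite_imageI finite_subset)
      then show ?thesis unfolding opt_def using that by (intro Max_ge) auto
    qed
    have "coloring_wiener ?G k f' \<le> (\<Sum>i=1..k. opt (card (color_class ?G f' i)))"
      unfolding coloring_wiener_def by (intro sum_mono opt) (auto simp: color_class_def)
    also have "\<dots> = (\<Sum>i=1..k. opt (card (color_class ?G f i)))"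
      by (rule sum_colors_cong_type[OF type])
    also have "\<dots> = coloring_wiener ?G k f"
      unfolding coloring_wiener_def opt_def using max
      by (intro sum.cong) (auto simp: wiener_maximizer_def)
    finally show ?thesis .
  qed
  then show "weak_maximizer ?G k f" using assms(3) by (simp add: weak_maximizer_def)
qed

end
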